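(* Let $\ell\in\mathbb C\setminus\{-2\}$, $\phi(t)=\frac{2}{\ell+2}t^{\frac{\ell+2}{2}}$, $\gamma=\frac{\ell}{2(\ell+2)}$, $c_\ell=\left(\frac{\ell+2}{4}\right)^{-\frac{\ell}{\ell+2}}$. The kernel function $$E(r,t;b;\gamma)=c_\ell\left((\phi(t)+\phi(b))^2-r^2\right)^{-\gamma}F\left(\gamma,\gamma;1;\frac{(\phi(t)-\phi(b))^2-r^2}{(\phi(t)+\phi(b))^2-r^2}\right)$$ solves the equation $$E_{tt}(r,t;b;\gamma)-(\phi'(t))^2E_{rr}(r,t;b;\gamma)=0$$ for all $t>b>0$, $r>0$ with $r^2\neq(\phi(t)+\phi(b))^2$.
   Context: $F(a,b;c;z)$ is Gauss's hypergeometric function, defined by the Gauss series on $|z|<1$ and by analytic continuation elsewhere. Where the argument of $F$ or the base of the power $(\cdot)^{-\gamma}$ lies on a branch cut, these functions are understood as (fixed) analytic branches near the point in question. Powers of the positive numbers $t,b$ are the usual ones, $t^z=e^{z\ln t}$. Note $(\phi'(t))^2=t^\ell$. *)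

theory Defs
  imports "HOL-Complex_Analysis.Complex_Analysis"
begin

section \<open>Gauss's hypergeometric function and its analytic branches\<close>

definition gauss_series :: "complex \<Rightarrow> complex \<Rightarrow> complex \<Rightarrow> complex \<Rightarrow> complex" where
  "gauss_series a b c = eval_fps (fps_hypergeo [a, b] [c] 1)"

lemma gauss_series_eq_suminf:
  "gauss_series a b c z =
     (\<Sum>n. pochhammer a n * pochhammer b n / (pochhammer c n * fact n) * z ^ n)"
  by (simp add: gauss_series_def eval_fps_def)

definition hyp2F1_cut :: "complex set" where
  "hyp2F1_cut = {complex_of_real x | x. x \<ge> 1}"

text \<open>
  The principal branch. The plane slit along \<open>[1, \<infinity>)\<close> is connected, so the continuation is
  unique there; the value of the chosen function on the cut itself is arbitrary and is never used.
\<close>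

definition hyp2F1 :: "complex \<Rightarrow> complex \<Rightarrow> complex \<Rightarrow> complex \<Rightarrow> complex" where
  "hyp2F1 a b c =
     (SOME f. f holomorphic_on (- hyp2F1_cut) \<and> (\<forall>z\<in>ball 0 1. f z = gauss_series a b c z))"

text \<open>
  Analytic continuation by finite chains of discs: \<open>hyp2F1_element a b c z\<^sub>0 \<rho> f\<close> says that
  \<open>f\<close>, restricted to the disc of centre \<open>z\<^sub>0\<close> and radius \<open>\<rho>\<close>, is obtained from the Gauss series
  in this way. The values of \<open>f\<close> outside that disc are unconstrained.
\<close>

inductive hyp2F1_element ::
  "complex \<Rightarrow> complex \<Rightarrow> complex \<Rightarrow> complex \<Rightarrow> real \<Rightarrow> (complex \<Rightarrow> complex) \<Rightarrow> bool"
  for a b c where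
  series: "hyp2F1_element a b c 0 1 (gauss_series a b c)"
| continue: "\<lbrakk>hyp2F1_element a b c z1 \<rho>1 f1; \<rho>2 > 0; f2 holomorphic_on ball z2 \<rho>2;
     ball z1 \<rho>1 \<inter> ball z2 \<rho>2 \<noteq> {}; \<And>z. z \<in> ball z1 \<rho>1 \<inter> ball z2 \<rho>2 \<Longrightarrow> f2 z = f1 z\<rbrakk>
   \<Longrightarrow> hyp2F1_element a b c z2 \<rho>2 f2"

text \<open>
  The meaning of \<open>F(a,b;c;\<cdot>)\<close> near \<open>z\<^sub>0\<close>: the principal branch off the cut, and any fixed
  analytic branch on a disc around \<open>z\<^sub>0\<close> if \<open>z\<^sub>0\<close> lies on the cut.
\<close>

definition hyp2F1_near ::
  "complex \<Rightarrow> complex \<Rightarrow> complex \<Rightarrow> complex \<Rightarrow> (complex \<Rightarrow> complex) \<Rightarrow> bool" where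
  "hyp2F1_near a b c z0 f \<longleftrightarrow>
     (if z0 \<in> hyp2F1_cut then \<exists>\<rho>>0. hyp2F1_element a b c z0 \<rho> f else f = hyp2F1 a b c)"

section \<open>Analytic branches of a complex power\<close>

text \<open>Likewise for \<open>w\<^sup>\<alpha>\<close>; on the cut, \<open>L\<close> is an analytic branch of the logarithm.\<close>

definition power_near :: "complex \<Rightarrow> complex \<Rightarrow> (complex \<Rightarrow> complex) \<Rightarrow> bool" where
  "power_near \<alpha> w0 p \<longleftrightarrow>
     (if w0 \<in> \<real>\<^sub>\<le>\<^sub>0
      then \<exists>\<rho>>0. \<exists>L. L holomorphic_on ball w0 \<rho> \<and>
             (\<forall>w\<in>ball w0 \<rho>. exp (L w) = w \<and> p w = exp (\<alpha> * L w))
      else p = (\<lambda>w. w powr \<alpha>))"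

section \<open>The kernel\<close>

definition phi :: "complex \<Rightarrow> real \<Rightarrow> complex" where
  "phi l t = 2 / (l + 2) * complex_of_real t powr ((l + 2) / 2)"

definition gam :: "complex \<Rightarrow> complex" where
  "gam l = l / (2 * (l + 2))"

text \<open>The constant is taken with the principal value of the power.\<close>

definition c_const :: "complex \<Rightarrow> complex" where
  "c_const l = ((l + 2) / 4) powr (- (l / (l + 2)))"

definition base_plus :: "complex \<Rightarrow> real \<Rightarrow> real \<Rightarrow> real \<Rightarrow> complex" where
  "base_plus l r t b = (phi l t + phi l b)\<^sup>2 - (complex_of_real r)\<^sup>2"

definition base_minus :: "complex \<Rightarrow> real \<Rightarrow> real \<Rightarrow> real \<Rightarrow> complex" where
  "base_minus l r t b = (phi l t - phi l b)\<^sup>2 - (complex_of_real r)\<^sup>2"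

text \<open>
  The parameters \<open>P\<close> and \<open>F\<close> are the chosen branches of \<open>w\<^sup>-\<^sup>\<gamma>\<close> and of \<open>F(\<gamma>,\<gamma>;1;\<cdot>)\<close>.
\<close>

definition kernel_E ::
  "complex \<Rightarrow> (complex \<Rightarrow> complex) \<Rightarrow> (complex \<Rightarrow> complex) \<Rightarrow> real \<Rightarrow> real \<Rightarrow> real \<Rightarrow> complex" where
  "kernel_E l P F r t b =
     c_const l * P (base_plus l r t b) * F (base_minus l r t b / base_plus l r t b)"

section \<open>Second derivatives of functions of a real variable\<close>

definition has_second_derivative ::
  "(real \<Rightarrow> 'a :: real_normed_vector) \<Rightarrow> 'a \<Rightarrow> real \<Rightarrow> bool" where
  "has_second_derivative f d2 x \<longleftrightarrow>
     (\<exists>f'. (\<forall>\<^sub>F y in nhds x. (f has_vector_derivative f' y) (at y)) \<and>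
           (f' has_vector_derivative d2) (at x))"

end

theory Submission
  imports Defs
begin

text \<open>
  Put \<open>x = \<phi>(t)\<close> and \<open>y = \<phi>(b)\<close>. Because \<open>\<phi> \<phi>'' = 2 \<gamma> (\<phi>')\<^sup>2\<close>, the equation becomes the
  Euler--Poisson--Darboux equation \<open>E\<^sub>x\<^sub>x + (2\<gamma>/x) E\<^sub>x = E\<^sub>r\<^sub>r\<close>. Write
  \<open>A = (x + y)\<^sup>2 - r\<^sup>2\<close> and \<open>z = ((x - y)\<^sup>2 - r\<^sup>2) / A\<close>, so that \<open>1 - z = 4xy / A\<close>. For
  \<open>E = A\<^sup>-\<^sup>\<gamma> F(z)\<close>, the difference of its two sides is \<open>4y / (xA) \<cdot> A\<^sup>-\<^sup>\<gamma>\<close> times Gauss's hypergeometric operator applied to \<open>F\<close> at \<open>z\<close>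
  (lemma \<open>wave_operator_identity\<close>), and this vanishes. Two properties of the chosen branches enter:
  the power satisfies \<open>P' = -\<gamma> P / w\<close> (lemma \<open>power_near_derivative\<close>), and \<open>F\<close> is holomorphic near
  the base point and satisfies Gauss's equation there (lemma \<open>hyp2F1_near_ode\<close>).

  The analytic work lies in the second property. Along a chain of discs the equation is inherited
  from the Gauss series by the identity theorem. The principal branch is introduced through a choice
  operator, so a continuation of the series to the plane slit along \<open>[1, \<infinity>)\<close> has to be
  exhibited. For \<open>c = 1\<close> and arbitrary complex \<open>a\<close>, \<open>b\<close> it comes from a conformal map:
  \<open>z = 4w / (1 + w)\<^sup>2\<close> sends the unit disc onto the slit plane, and with \<open>U = F\<close> and \<open>V = z F'\<close>,
  regarded as functions of \<open>w\<close>, Gauss's equation becomes the first-order system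
  \<open>w (1 + w) U' = (1 - w) V\<close>, \<open>(1 - w\<^sup>2) V' = 4 ((a + b) V + a b U)\<close>. Its finite singular points are
  \<open>0\<close>, where it has a power series solution, and \<open>\<plusminus>1\<close>; the series therefore converges in the
  whole unit disc (lemma \<open>pullback_recurrence_conv_radius\<close>), and composing it with the inverse
  conformal map gives the continuation.
\<close>

section \<open>Gauss's equation pulled back to the unit disc\<close>

text \<open>
  The left-hand side of Gauss's equation for \<open>c = 1\<close>.
\<close>

definition hypergeo_ode ::
  "complex \<Rightarrow> complex \<Rightarrow> (complex \<Rightarrow> complex) \<Rightarrow> complex \<Rightarrow> complex" where
  "hypergeo_ode a b f z =
     z * (1 - z) * deriv (deriv f) z + (1 - (a + b + 1) * z) * deriv f z - a * b * f z"

text \<open>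
  The majorant \<open>T\<close> grows at most polynomially, like \<open>n ^ K\<close>; the ratio test gives radius of
  convergence at least 1. The bound starts at \<open>n = 1\<close> because \<open>T\<close> will carry factors \<open>n\<close>.
\<close>

lemma conv_radius_ge_1_if_subexponential_growth:
  fixes c :: "nat \<Rightarrow> complex" and T :: "nat \<Rightarrow> real"
  assumes step: "\<And>n. T (Suc n) \<le> (1 + K / (real n + 1)) * T n"
    and bound: "\<And>n. n \<ge> 1 \<Longrightarrow> norm (c n) \<le> T n" and nonneg: "\<And>n. 0 \<le> T n"
  shows "conv_radius c \<ge> 1"
proof (rule conv_radius_geI_ex')
  fix r :: real assume r: "0 < r" "ereal r < 1"
  hence r1: "r < 1" by simp
  define q where "q = (1 + r) / 2"
  have q: "q < 1" "r < q" using r1 by (auto simp: q_def)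
  have "(\<lambda>n. (1 + K / (real n + 1)) * r) \<longlonglongrightarrow> (1 + 0) * r"
    by (intro tendsto_intros) real_asymp
  hence "eventually (\<lambda>n. (1 + K / (real n + 1)) * r < q) sequentially"
    using q by (intro order_tendstoD(2)) auto
  then obtain N where N: "\<And>n. n \<ge> N \<Longrightarrow> (1 + K / (real n + 1)) * r < q"
    by (auto simp: eventually_sequentially)
  have "summable (\<lambda>n. T n * r ^ n)"
  proof (rule summable_ratio_test[OF q(1)])
    fix n assume n: "n \<ge> N"
    have "T (Suc n) * r ^ Suc n \<le> (1 + K / (real n + 1)) * T n * r ^ Suc n"
      using step[of n] r by (intro mult_right_mono) auto
    also have "\<dots> = ((1 + K / (real n + 1)) * r) * (T n * r ^ n)" by simp
    also have "\<dots> \<le> q * (T n * r ^ n)"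
      using N[OF n] nonneg[of n] r by (intro mult_right_mono) auto
    finally show "norm (T (Suc n) * r ^ Suc n) \<le> q * norm (T n * r ^ n)"
      using nonneg r by (simp add: abs_mult)
  qed
  thus "summable (\<lambda>n. c n * of_real r ^ n)"
  proof (rule summable_comparison_test_ev[rotated])
    show "\<forall>\<^sub>F n in sequentially. norm (c n * of_real r ^ n) \<le> T n * r ^ n"
      using eventually_ge_at_top[of 1]
      by eventually_elim (use bound r in \<open>auto simp: norm_mult norm_power intro!: mult_right_mono\<close>)
  qed
qed

text \<open>
  These are the recurrences for the power series coefficients of the system
  \<open>w (1 + w) U' = (1 - w) V\<close>, \<open>(1 - w\<^sup>2) V' = 4 (p V + q U)\<close>. Bounding the coefficients themselves
  would lose: the leading terms of the recurrences carry \<open>n v\<^sub>n\<close> to \<open>(n + 2) v\<^sub>n\<^sub>+\<^sub>2\<close> and \<open>n u\<^sub>n\<close> to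
  \<open>(n + 1) u\<^sub>n\<^sub>+\<^sub>1\<close> in absolute value. So the weighted quantity \<open>T\<close> is used, and all the other terms
  are \<open>O(T\<^sub>n / n)\<close>.
\<close>

lemma pullback_recurrence_conv_radius:
  fixes u v :: "nat \<Rightarrow> complex" and p q :: complex
  assumes v_rec: "\<And>n. of_nat (n + 2) * v (n + 2)
                     = of_nat n * v n + 4 * (p * v (n + 1) + q * u (n + 1))"
    and u_rec: "\<And>n. of_nat (n + 1) * u (n + 1) = v (n + 1) - v n - of_nat n * u n"
    and v_0: "v 0 = 0"
  shows "conv_radius v \<ge> 1" "conv_radius u \<ge> 1"
proof -
  define T where "T n = n * norm (v n) + (n + 1) * norm (v (n + 1)) + n * norm (u n)" for n
  \<comment> \<open>1 + 2 from \<open>v\<^sub>n\<^sub>+\<^sub>1\<close> and \<open>v\<^sub>n\<close> in the second recurrence, the rest from \<open>4 (p v\<^sub>n\<^sub>+\<^sub>1 + q u\<^sub>n\<^sub>+\<^sub>1)\<close>\<close>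
  define K where "K = 3 + 4 * norm p + 16 * norm q"
  have T_nonneg: "0 \<le> T n" for n by (auto simp: T_def)
  have v_bound: "n * norm (v n) \<le> T n" and v1_bound: "(n + 1) * norm (v (n + 1)) \<le> T n"
    and u_bound: "n * norm (u n) \<le> T n" for n
    by (auto simp: T_def)
  have step: "T (Suc n) \<le> (1 + K / (real n + 1)) * T n" for n
  proof -
    define e where "e = T n / (real n + 1)"
    have v1: "norm (v (n + 1)) \<le> e" using v1_bound[of n] by (simp add: e_def field_simps)
    have v0: "norm (v n) \<le> 2 * e"
    proof (cases "n = 0")
      case False
      hence "(real n + 1) * norm (v n) \<le> 2 * n * norm (v n)" by (intro mult_right_mono) auto
      thus ?thesis using v_bound[of n] by (simp add: e_def field_simps)
    qed (auto simp: e_def T_nonneg v_0)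
    have "(n + 1) * norm (u (n + 1)) = norm (v (n + 1) - v n - of_nat n * u n)"
      by (simp only: norm_mult norm_of_nat flip: u_rec)
    also have "\<dots> \<le> norm (v (n + 1)) + norm (v n) + norm (of_nat n * u n)"
      by (intro order.trans[OF norm_triangle_ineq4] add_right_mono norm_triangle_ineq4)
    finally have u1': "(n + 1) * norm (u (n + 1)) \<le> norm (v (n + 1)) + norm (v n) + n * norm (u n)"
      by (simp add: norm_mult)
    have "e \<le> T n" using T_nonneg[of n] by (simp add: e_def field_simps)
    hence "(real n + 1) * norm (u (n + 1)) \<le> 4 * T n"
      using u1' v1 v0 u_bound[of n] by (simp add: algebra_simps)
    hence u1: "norm (u (n + 1)) \<le> 4 * e" by (simp add: e_def field_simps)
    have "(n + 2) * norm (v (n + 2))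
        = norm (of_nat n * v n + 4 * (p * v (n + 1) + q * u (n + 1)))"
      by (simp only: norm_mult norm_of_nat flip: v_rec)
    also have "\<dots> \<le> norm (of_nat n * v n) + norm (4 * (p * v (n + 1) + q * u (n + 1)))"
      by (rule norm_triangle_ineq)
    also have "norm (4 * (p * v (n + 1) + q * u (n + 1)))
        \<le> 4 * (norm p * norm (v (n + 1)) + norm q * norm (u (n + 1)))"
      using norm_triangle_ineq[of "p * v (n + 1)" "q * u (n + 1)"]
      by (simp add: norm_mult del: distrib_left_numeral)
    finally have v2: "(n + 2) * norm (v (n + 2))
        \<le> n * norm (v n) + 4 * (norm p * norm (v (n + 1)) + norm q * norm (u (n + 1)))"
      by (simp only: norm_mult norm_of_nat)
    have pv: "norm p * norm (v (n + 1)) \<le> norm p * e"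
      and qu: "norm q * norm (u (n + 1)) \<le> norm q * (4 * e)"
      by (intro mult_left_mono v1 u1 norm_ge_zero)+
    have "T (Suc n) = (n + 1) * norm (v (n + 1)) + (n + 2) * norm (v (n + 2))
                      + (n + 1) * norm (u (n + 1))"
      by (simp add: T_def)
    also have "\<dots> \<le> (n + 1) * norm (v (n + 1))
        + (n * norm (v n) + 4 * (norm p * e + norm q * (4 * e))) + (3 * e + n * norm (u n))"
    proof (intro add_mono order.refl)
      show "(n + 2) * norm (v (n + 2)) \<le> n * norm (v n) + 4 * (norm p * e + norm q * (4 * e))"
        by (rule order.trans[OF v2], intro add_mono mult_left_mono pv qu) auto
      show "(n + 1) * norm (u (n + 1)) \<le> 3 * e + n * norm (u n)"
        using v1 v0 by (intro order.trans[OF u1'] add_right_mono) simp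
    qed
    also have "\<dots> = T n + K * e"
      unfolding T_def[of n] K_def by (simp add: algebra_simps)
    also have "\<dots> = (1 + K / (real n + 1)) * T n" by (simp add: e_def algebra_simps)
    finally show ?thesis .
  qed
  have le_T: "x \<le> T n" if "n \<ge> 1" "0 \<le> x" "n * x \<le> T n" for n :: nat and x :: real
    using that mult_right_mono[of 1 "real n" x] by simp
  show "conv_radius v \<ge> 1"
    using le_T[OF _ norm_ge_zero v_bound]
    by (intro conv_radius_ge_1_if_subexponential_growth[OF step _ T_nonneg]) auto
  show "conv_radius u \<ge> 1"
    using le_T[OF _ norm_ge_zero u_bound]
    by (intro conv_radius_ge_1_if_subexponential_growth[OF step _ T_nonneg]) auto
qed

text \<open>
  The recurrences solved for the highest coefficient. The value \<open>4 q\<close> is what the equation for \<open>V'\<close>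
  forces at order 0; \<open>V\<close> vanishes at 0 because it stands for \<open>z F'\<close>.
\<close>

fun pullback_coeff_v pullback_coeff_u :: "complex \<Rightarrow> complex \<Rightarrow> nat \<Rightarrow> complex" where
  "pullback_coeff_v p q 0 = 0"
| "pullback_coeff_v p q (Suc 0) = 4 * q"
| "pullback_coeff_v p q (Suc (Suc n)) =
     (of_nat n * pullback_coeff_v p q n
       + 4 * (p * pullback_coeff_v p q (Suc n) + q * pullback_coeff_u p q (Suc n)))
     / of_nat (n + 2)"
| "pullback_coeff_u p q 0 = 1"
| "pullback_coeff_u p q (Suc n) =
     (pullback_coeff_v p q (Suc n) - pullback_coeff_v p q n - of_nat n * pullback_coeff_u p q n)
     / of_nat (n + 1)"

lemma fps_conv_radius_X_mult: "fps_conv_radius f \<le> fps_conv_radius (fps_X * f)"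
  for f :: "complex fps"
  using fps_conv_radius_mult[of fps_X f] by simp

lemma pullback_system_solvable:
  fixes p q :: complex
  obtains U V :: "complex \<Rightarrow> complex" where
    "U holomorphic_on ball 0 1" "V holomorphic_on ball 0 1" "U 0 = 1"
    "\<And>w. w \<in> ball 0 1 \<Longrightarrow> w * (1 + w) * deriv U w = (1 - w) * V w"
    "\<And>w. w \<in> ball 0 1 \<Longrightarrow> (1 - w\<^sup>2) * deriv V w = 4 * (p * V w + q * U w)"
proof
  let ?v = "pullback_coeff_v p q" and ?u = "pullback_coeff_u p q"
  let ?fv = "Abs_fps ?v" and ?fu = "Abs_fps ?u"
  have v_rec: "of_nat (n + 2) * ?v (n + 2) = of_nat n * ?v n + 4 * (p * ?v (n + 1) + q * ?u (n + 1))"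
    for n by (simp del: of_nat_Suc of_nat_add pullback_coeff_u.simps add: of_nat_eq_0_iff)
  have u_rec: "of_nat (n + 1) * ?u (n + 1) = ?v (n + 1) - ?v n - of_nat n * ?u n" for n
    by (simp del: of_nat_Suc of_nat_add add: of_nat_eq_0_iff)
  note radius = pullback_recurrence_conv_radius[OF v_rec u_rec]
  have rad: "fps_conv_radius ?fv \<ge> 1" "fps_conv_radius ?fu \<ge> 1"
    using radius by (simp_all add: fps_conv_radius_def)
  have rad': "fps_conv_radius (fps_deriv ?fv) \<ge> 1" "fps_conv_radius (fps_deriv ?fu) \<ge> 1"
    by (rule order.trans[OF rad(1) fps_conv_radius_deriv], rule order.trans[OF rad(2) fps_conv_radius_deriv])
  have lt: "ereal (norm w) < R" if "w \<in> ball 0 1" "R \<ge> 1" for w :: complex and R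
    using that by (metis dist_0_norm ereal_less_eq(3) less_ereal.simps(1) less_le_trans mem_ball one_ereal_def)
  show "eval_fps ?fu holomorphic_on ball 0 1" "eval_fps ?fv holomorphic_on ball 0 1"
    using rad by (auto intro!: holomorphic_on_eval_fps lt)
  show "eval_fps ?fu 0 = 1" by (simp add: eval_fps_at_0)
  fix w :: complex assume w: "w \<in> ball 0 1"
  have deriv: "deriv (eval_fps ?fu) w = eval_fps (fps_deriv ?fu) w"
              "deriv (eval_fps ?fv) w = eval_fps (fps_deriv ?fv) w"
    using lt[OF w] rad by (auto intro!: DERIV_imp_deriv has_field_derivative_eval_fps)
  have X: "eval_fps (fps_X * f) w = w * eval_fps f w \<and> fps_conv_radius (fps_X * f) \<ge> 1"
    if "fps_conv_radius f \<ge> 1" for f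
    using that lt[OF w that] order.trans[OF that fps_conv_radius_X_mult] by (simp add: eval_fps_mult)
  have C: "eval_fps (fps_const c * f) w = c * eval_fps f w \<and> fps_conv_radius (fps_const c * f) \<ge> 1"
    if "fps_conv_radius f \<ge> 1" for f c
    using that lt[OF w that] order.trans[OF _ fps_conv_radius_mult[of "fps_const c" f], of 1]
    by (simp add: eval_fps_mult)
  have A: "eval_fps (f + g) w = eval_fps f w + eval_fps g w \<and> fps_conv_radius (f + g) \<ge> 1"
    and D: "eval_fps (f - g) w = eval_fps f w - eval_fps g w \<and> fps_conv_radius (f - g) \<ge> 1"
    if "fps_conv_radius f \<ge> 1" "fps_conv_radius g \<ge> 1" for f g
    using that lt[OF w that(1)] lt[OF w that(2)]
      order.trans[OF _ fps_conv_radius_add[of f g], of 1]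
      order.trans[OF _ fps_conv_radius_diff[of f g], of 1]
    by (simp_all add: eval_fps_add eval_fps_diff)
  have "fps_X * fps_deriv ?fu + fps_X * (fps_X * fps_deriv ?fu) = ?fv - fps_X * ?fv"
  proof (rule fps_ext)
    fix n
    show "(fps_X * fps_deriv ?fu + fps_X * (fps_X * fps_deriv ?fu)) $ n = (?fv - fps_X * ?fv) $ n"
    proof (cases n)
      case (Suc m)
      thus ?thesis using u_rec[of m]
        by (cases m) (simp_all del: pullback_coeff_u.simps pullback_coeff_v.simps(2-) add: algebra_simps)
    qed simp
  qed
  hence "eval_fps (fps_X * fps_deriv ?fu + fps_X * (fps_X * fps_deriv ?fu)) w
      = eval_fps (?fv - fps_X * ?fv) w"
    by simp
  thus "w * (1 + w) * deriv (eval_fps ?fu) w = (1 - w) * eval_fps ?fv w"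
    unfolding deriv by (simp only: X A D rad rad') (simp add: algebra_simps)
  have "fps_deriv ?fv - fps_X * (fps_X * fps_deriv ?fv) = fps_const (4 * p) * ?fv + fps_const (4 * q) * ?fu"
  proof (rule fps_ext)
    fix n
    show "(fps_deriv ?fv - fps_X * (fps_X * fps_deriv ?fv)) $ n
        = (fps_const (4 * p) * ?fv + fps_const (4 * q) * ?fu) $ n"
    proof (cases n)
      case (Suc m)
      thus ?thesis using v_rec[of m]
        by (cases m) (simp_all del: pullback_coeff_u.simps(2) pullback_coeff_v.simps(2-) add: algebra_simps)
    qed simp
  qed
  hence "eval_fps (fps_deriv ?fv - fps_X * (fps_X * fps_deriv ?fv)) w
      = eval_fps (fps_const (4 * p) * ?fv + fps_const (4 * q) * ?fu) w"
    by simp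
  thus "(1 - w\<^sup>2) * deriv (eval_fps ?fv) w = 4 * (p * eval_fps ?fv w + q * eval_fps ?fu w)"
    unfolding deriv
    by (simp only: X A D C rad rad') (simp add: algebra_simps power2_eq_square)
qed

text \<open>
  Comparing coefficients in the equation gives \<open>(n + 1)\<^sup>2 h\<^sub>n\<^sub>+\<^sub>1 = (n + a) (n + b) h\<^sub>n\<close>, the ratio of
  consecutive terms of the Gauss series. The exponent 0 is a double one at \<open>z = 0\<close>, so a holomorphic
  solution is fixed by its value there.
\<close>

lemma hypergeo_ode_determines_gauss_series:
  assumes f: "f holomorphic_on ball 0 1" "f 0 = 1"
    and ode: "\<And>z. z \<in> ball 0 1 \<Longrightarrow> hypergeo_ode a b f z = 0"
    and z: "z \<in> ball 0 1"
  shows "f z = gauss_series a b 1 z"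
proof -
  define h where "h = fps_expansion f 0"
  have h: "f has_fps_expansion h"
    unfolding h_def using f by (intro has_fps_expansion_fps_expansion[of "ball 0 1"]) auto
  have "(\<lambda>z. hypergeo_ode a b f z) has_fps_expansion
      (fps_X * (1 - fps_X) * fps_deriv (fps_deriv h) + (1 - fps_const (a + b + 1) * fps_X) * fps_deriv h
        - fps_const (a * b) * h)"
    unfolding hypergeo_ode_def by (intro fps_expansion_intros h)
  moreover have "(\<lambda>z. hypergeo_ode a b f z) has_fps_expansion 0"
  proof -
    have "eventually (\<lambda>z. z \<in> ball 0 1) (nhds (0 :: complex))"
      by (intro eventually_nhds_in_open) auto
    hence "eventually (\<lambda>z. hypergeo_ode a b f z = 0) (nhds 0)"
      by eventually_elim (rule ode)
    thus ?thesis by (subst has_fps_expansion_cong[OF _ refl, of _ "\<lambda>_. 0"]) simp_all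
  qed
  ultimately have eq: "fps_X * (1 - fps_X) * fps_deriv (fps_deriv h)
      + (1 - fps_const (a + b + 1) * fps_X) * fps_deriv h - fps_const (a * b) * h = 0"
    by (rule fps_expansion_unique_complex)
  have rec: "of_nat (n + 1) ^ 2 * h $ (n + 1) = (of_nat n + a) * (of_nat n + b) * h $ n" for n
  proof -
    have "fps_X * (fps_deriv (fps_deriv h) - fps_X * fps_deriv (fps_deriv h))
        + (fps_deriv h - fps_const (a + b + 1) * (fps_X * fps_deriv h)) - fps_const (a * b) * h = 0"
      using eq by (simp only: ring_distribs mult.assoc mult_1_left)
    from fps_eq_iff[THEN iffD1, OF this, rule_format, of n]
    show ?thesis
      by (cases n; cases "n - 1") (simp_all add: algebra_simps power2_eq_square)
  qed
  have "h $ n = fps_hypergeo [a, b] [1] 1 $ n" for n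
  proof (induction n)
    case 0
    have "h $ 0 = f 0" using h by (metis has_fps_expansion_imp_0_eq_fps_nth_0)
    thus ?case using f by simp
  next
    case (Suc n)
    have nz: "of_nat (n + 1) \<noteq> (0 :: complex)" by (simp del: of_nat_Suc of_nat_add)
    have "h $ Suc n = (of_nat n + a) * (of_nat n + b) * h $ n / of_nat (n + 1) ^ 2"
      using rec[of n] nz by (simp add: field_simps del: of_nat_Suc of_nat_add)
    thus ?case using nz unfolding Suc.IH
      by (simp add: pochhammer_Suc field_simps power2_eq_square)
  qed
  hence "h = fps_hypergeo [a, b] [1] 1" by (rule fps_ext)
  moreover have "eval_fps h z = f z"
    unfolding h_def using z f(1) by (subst eval_fps_expansion'[of _ _ 1]) auto
  ultimately show ?thesis by (simp add: gauss_series_def)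
qed

section \<open>Continuation to the slit plane\<close>

lemma not_in_hyp2F1_cut_iff: "z \<notin> hyp2F1_cut \<longleftrightarrow> 1 - z \<notin> \<real>\<^sub>\<le>\<^sub>0"
  by (auto simp: hyp2F1_cut_def complex_nonpos_Reals_iff complex_eq_iff)

lemma open_slit_plane: "open (- hyp2F1_cut)"
proof -
  have "- hyp2F1_cut = (\<lambda>z. 1 - z) -` (- \<real>\<^sub>\<le>\<^sub>0)"
    using not_in_hyp2F1_cut_iff by auto
  thus ?thesis by (simp only:) (intro open_vimage continuous_intros, auto)
qed

lemma ball_subset_slit_plane: "ball 0 1 \<subseteq> - hyp2F1_cut"
  by (auto simp: hyp2F1_cut_def)

lemma connected_slit_plane: "connected (- hyp2F1_cut)"
proof -
  have "hyp2F1_cut = complex_of_real ` {1..}" by (auto simp: hyp2F1_cut_def)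
  thus ?thesis using starlike_imp_connected[OF starlike_slotted_complex_plane_right[of 1]] by simp
qed

text \<open>
  With \<open>s = sqrt (1 - z)\<close>, which has positive real part off the cut, \<open>w = (1 - s) / (1 + s)\<close> inverts
  \<open>z = 4w / (1 + w)\<^sup>2\<close> and lies in the unit disc. Then \<open>f = U(w)\<close> and \<open>g = V(w)\<close> satisfy
  \<open>z f' = g\<close> and \<open>(1 - z) g' = (a + b) g + a b f\<close>; eliminating \<open>g\<close> gives Gauss's equation.
\<close>

lemma hypergeo_branch_on_slit_plane_exists:
  obtains f where "f holomorphic_on (- hyp2F1_cut)" "f 0 = 1"
    "\<And>z. z \<notin> hyp2F1_cut \<Longrightarrow> hypergeo_ode a b f z = 0"
proof -
  define p where "p = a + b"
  define q where "q = a * b"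
  obtain U V :: "complex \<Rightarrow> complex" where UV:
    "U holomorphic_on ball 0 1" "V holomorphic_on ball 0 1" "U 0 = 1"
    "\<And>w. w \<in> ball 0 1 \<Longrightarrow> w * (1 + w) * deriv U w = (1 - w) * V w"
    "\<And>w. w \<in> ball 0 1 \<Longrightarrow> (1 - w\<^sup>2) * deriv V w = 4 * (p * V w + q * U w)"
    by (rule pullback_system_solvable[of p q]) blast
  define k where "k z = (1 - csqrt (1 - z)) / (1 + csqrt (1 - z))" for z
  define f where "f z = U (k z)" for z
  define g where "g z = V (k z)" for z
  have k: "k z \<in> ball 0 1" "(k has_field_derivative 1 / (s * (1 + s)\<^sup>2)) (at z)"
    "s \<noteq> 0" "1 + s \<noteq> 0" "s\<^sup>2 = 1 - z"
    if z: "z \<notin> hyp2F1_cut" and s: "s = csqrt (1 - z)" for z s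
  proof -
    have nz: "1 - z \<notin> \<real>\<^sub>\<le>\<^sub>0" using z not_in_hyp2F1_cut_iff by blast
    have "Re s \<noteq> 0"
    proof
      assume "Re s = 0"
      hence "s\<^sup>2 \<in> \<real>\<^sub>\<le>\<^sub>0" by (simp add: complex_nonpos_Reals_iff power2_eq_square)
      thus False using nz s by simp
    qed
    hence Re: "Re s > 0" using csqrt_principal[of "1 - z"] s by auto
    show s0: "s \<noteq> 0" and s1: "1 + s \<noteq> 0" using Re by (auto simp: complex_eq_iff)
    show "s\<^sup>2 = 1 - z" using s by simp
    have "norm (1 - s) ^ 2 < norm (1 + s) ^ 2"
      using Re by (simp add: cmod_power2) (simp add: power2_eq_square algebra_simps)
    hence "norm (1 - s) < norm (1 + s)" by (rule power2_less_imp_less) simp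
    thus "k z \<in> ball 0 1" using s1 by (simp add: k_def s norm_divide)
    show "(k has_field_derivative 1 / (s * (1 + s)\<^sup>2)) (at z)"
      unfolding k_def[abs_def] s using nz s0[unfolded s] s1[unfolded s]
      by (auto intro!: derivative_eq_intros simp: field_simps power2_eq_square)
  qed
  have f': "(f has_field_derivative deriv U (k z) * (1 / (s * (1 + s)\<^sup>2))) (at z)"
    and g': "(g has_field_derivative deriv V (k z) * (1 / (s * (1 + s)\<^sup>2))) (at z)"
    if "z \<notin> hyp2F1_cut" "s = csqrt (1 - z)" for z s
    unfolding f_def[abs_def] g_def[abs_def]
    by (rule DERIV_chain2[OF holomorphic_derivI[OF UV(1) open_ball k(1)[OF that]] k(2)[OF that]],
        rule DERIV_chain2[OF holomorphic_derivI[OF UV(2) open_ball k(1)[OF that]] k(2)[OF that]])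
  have f_hol: "f holomorphic_on - hyp2F1_cut"
    using f'[OF _ refl] by (auto simp: holomorphic_on_open[OF open_slit_plane])
  have f_g: "z * deriv f z = g z" if z: "z \<notin> hyp2F1_cut" for z
  proof -
    define s where "s = csqrt (1 - z)"
    note s = k[OF z s_def]
    have z_s: "z = 1 - s\<^sup>2" using s(5) by simp
    define c where "c = 1 / (1 + s)"
    have c: "c * (1 + s) = 1" using s(4) by (simp add: c_def)
    have "k z = (1 - s) * c" by (simp add: k_def s_def c_def)
    moreover from this have "1 + k z = 2 * c" "1 - k z = 2 * s * c"
      using c by algebra+
    ultimately have "(1 - s) * c * (2 * c) * deriv U (k z) = 2 * s * c * g z"
      using UV(4)[OF s(1)] by (simp only: g_def)
    hence U: "(1 - s) * deriv U (k z) = s * (1 + s) * g z"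
      using c by algebra
    have "deriv f z = deriv U (k z) * (1 / (s * (1 + s)\<^sup>2))"
      by (rule DERIV_imp_deriv[OF f'[OF z s_def]])
    hence "z * deriv f z = ((1 - s) * deriv U (k z)) * (1 + s) / (s * (1 + s)\<^sup>2)"
      unfolding z_s by (simp add: power2_eq_square algebra_simps)
    also have "\<dots> = g z" unfolding U using s(3,4) by (simp add: power2_eq_square)
    finally show ?thesis .
  qed
  have g_f: "(1 - z) * deriv g z = p * g z + q * f z" if z: "z \<notin> hyp2F1_cut" for z
  proof -
    define s where "s = csqrt (1 - z)"
    note s = k[OF z s_def]
    have k_s: "k z = (1 - s) / (1 + s)" by (simp add: k_def s_def)
    have "1 - (k z)\<^sup>2 = 4 * s / (1 + s)\<^sup>2"
      using s(4) by (simp add: k_s divide_simps) (simp add: power2_eq_square algebra_simps)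
    hence "4 * (s / (1 + s)\<^sup>2 * deriv V (k z)) = 4 * (p * g z + q * f z)"
      using UV(5)[OF s(1)] by (simp add: f_def g_def mult.assoc)
    hence "s / (1 + s)\<^sup>2 * deriv V (k z) = p * g z + q * f z"
      by (simp only: mult_cancel_left) simp
    moreover have "deriv g z = deriv V (k z) * (1 / (s * (1 + s)\<^sup>2))"
      by (rule DERIV_imp_deriv[OF g'[OF z s_def]])
    moreover have "1 - z = s * s" using s(5) by (simp add: power2_eq_square)
    ultimately show ?thesis using s(3) by simp
  qed
  have ode: "hypergeo_ode a b f z = 0" if z: "z \<notin> hyp2F1_cut" for z
  proof -
    have "(deriv f has_field_derivative deriv (deriv f) z) (at z)"
      using holomorphic_deriv[OF f_hol open_slit_plane] open_slit_plane z
      by (auto intro: holomorphic_derivI)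
    hence "((\<lambda>z. z * deriv f z) has_field_derivative z * deriv (deriv f) z + deriv f z) (at z)"
      by (auto intro!: derivative_eq_intros)
    hence "(g has_field_derivative z * deriv (deriv f) z + deriv f z) (at z)"
      by (rule has_field_derivative_transform_within_open[OF _ open_slit_plane])
         (use z f_g in auto)
    hence "deriv g z = z * deriv (deriv f) z + deriv f z" by (rule DERIV_imp_deriv)
    with g_f[OF z] f_g[OF z, symmetric] show ?thesis
      by (simp add: hypergeo_ode_def p_def q_def algebra_simps)
  qed
  show ?thesis
    by (rule that[OF f_hol _ ode]) (auto simp: f_def k_def UV)
qed

lemma holomorphic_on_hypergeo_ode:
  assumes "f holomorphic_on S" "open S"
  shows "hypergeo_ode a b f holomorphic_on S"
  unfolding hypergeo_ode_def[abs_def] using assms by (intro holomorphic_intros holomorphic_deriv)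

lemma hypergeo_ode_cong:
  assumes "open S" "\<And>w. w \<in> S \<Longrightarrow> f w = g w" "z \<in> S"
  shows "hypergeo_ode a b f z = hypergeo_ode a b g z"
proof -
  have ev: "eventually (\<lambda>w. f w = g w) (nhds w)" if "w \<in> S" for w
    using eventually_nhds_in_open[OF assms(1) that] by eventually_elim (rule assms(2))
  have "eventually (\<lambda>w. deriv f w = deriv g w) (nhds z)"
    using eventually_nhds_in_open[OF assms(1,3)] by eventually_elim (rule deriv_cong_ev[OF ev refl])
  hence "deriv (deriv f) z = deriv (deriv g) z" by (rule deriv_cong_ev[OF _ refl])
  thus ?thesis
    using deriv_cong_ev[OF ev[OF assms(3)] refl] assms(2,3) by (simp add: hypergeo_ode_def)
qed

text \<open>
  Permanence of the differential equation: \<open>hypergeo_ode a b f\<close> is itself holomorphic, so it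
  vanishes on all of a domain once it vanishes on an open part of it.
\<close>

lemma hypergeo_ode_continuation:
  assumes f: "f holomorphic_on S" "open S" "connected S"
    and U: "open U" "U \<noteq> {}" "U \<subseteq> S" "\<And>z. z \<in> U \<Longrightarrow> f z = g z"
    and ode: "\<And>z. z \<in> U \<Longrightarrow> hypergeo_ode a b g z = 0" and z: "z \<in> S"
  shows "hypergeo_ode a b f z = 0"
proof (rule analytic_continuation_open[of U S "hypergeo_ode a b f" "\<lambda>_. 0"])
  show "hypergeo_ode a b f z = 0" if "z \<in> U" for z
    using hypergeo_ode_cong[OF U(1,4) that] ode[OF that] by simp
qed (use f U z in \<open>auto intro: holomorphic_on_hypergeo_ode\<close>)

lemma gauss_series_continuation_exists:
  obtains f where "f holomorphic_on (- hyp2F1_cut)"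
    "\<And>z. z \<in> ball 0 1 \<Longrightarrow> f z = gauss_series a b 1 z"
    "\<And>z. z \<notin> hyp2F1_cut \<Longrightarrow> hypergeo_ode a b f z = 0"
proof -
  obtain f where f: "f holomorphic_on (- hyp2F1_cut)" "f 0 = 1"
    "\<And>z. z \<notin> hyp2F1_cut \<Longrightarrow> hypergeo_ode a b f z = 0"
    by (rule hypergeo_branch_on_slit_plane_exists[of a b]) blast
  have "f z = gauss_series a b 1 z" if "z \<in> ball 0 1" for z
    by (rule hypergeo_ode_determines_gauss_series[where f = f, OF _ f(2) _ that])
       (use f ball_subset_slit_plane in \<open>auto intro: holomorphic_on_subset\<close>)
  with f show ?thesis using that by blast
qed

text \<open>
  Read off from the continuation, of which the series is the restriction to the unit disc; this
  avoids differentiating the series term by term.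
\<close>

lemma gauss_series_ode:
  "gauss_series a b 1 holomorphic_on ball 0 1"
  "z \<in> ball 0 1 \<Longrightarrow> hypergeo_ode a b (gauss_series a b 1) z = 0"
proof -
  obtain f where f: "f holomorphic_on (- hyp2F1_cut)"
    "\<And>z. z \<in> ball 0 1 \<Longrightarrow> f z = gauss_series a b 1 z"
    "\<And>z. z \<notin> hyp2F1_cut \<Longrightarrow> hypergeo_ode a b f z = 0"
    by (rule gauss_series_continuation_exists[of a b]) blast
  show hol: "gauss_series a b 1 holomorphic_on ball 0 1"
    using holomorphic_on_subset[OF f(1) ball_subset_slit_plane] f(2)
    by (rule holomorphic_transform)
  assume z: "z \<in> ball 0 1"
  have "hypergeo_ode a b (gauss_series a b 1) z = hypergeo_ode a b f z"
    by (rule hypergeo_ode_cong[OF open_ball _ z]) (simp add: f(2))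
  thus "hypergeo_ode a b (gauss_series a b 1) z = 0"
    using f(3) z ball_subset_slit_plane by auto
qed

text \<open>
  With a continuation at hand, the choice operator in the definition does select one.
\<close>

lemma hyp2F1_principal_branch:
  "hyp2F1 a b 1 holomorphic_on (- hyp2F1_cut)"
  "z \<in> ball 0 1 \<Longrightarrow> hyp2F1 a b 1 z = gauss_series a b 1 z"
proof -
  obtain f where "f holomorphic_on (- hyp2F1_cut)"
    "\<And>z. z \<in> ball 0 1 \<Longrightarrow> f z = gauss_series a b 1 z"
    by (rule gauss_series_continuation_exists[of a b]) blast
  hence "\<exists>f. f holomorphic_on (- hyp2F1_cut) \<and> (\<forall>z\<in>ball 0 1. f z = gauss_series a b 1 z)"
    by blast
  from someI_ex[OF this]
  have *: "hyp2F1 a b 1 holomorphic_on (- hyp2F1_cut)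
      \<and> (\<forall>z\<in>ball 0 1. hyp2F1 a b 1 z = gauss_series a b 1 z)"
    unfolding hyp2F1_def .
  thus "hyp2F1 a b 1 holomorphic_on (- hyp2F1_cut)" ..
  from * show "z \<in> ball 0 1 \<Longrightarrow> hyp2F1 a b 1 z = gauss_series a b 1 z" by blast
qed

text \<open>
  A disc of the chain may contain the singular points 0 or 1. That does no harm: the equation is
  written without denominators, so the identity theorem carries it to such points as well.
\<close>

lemma hyp2F1_element_ode:
  assumes "hyp2F1_element a b 1 z0 \<rho> f"
  shows "f holomorphic_on ball z0 \<rho> \<and> (\<forall>z\<in>ball z0 \<rho>. hypergeo_ode a b f z = 0)"
  using assms
proof induction
  case series
  show ?case using gauss_series_ode by blast
next
  case (continue z1 \<rho>1 f1 \<rho>2 f2 z2)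
  have "hypergeo_ode a b f2 z = 0" if "z \<in> ball z2 \<rho>2" for z
    by (rule hypergeo_ode_continuation[of f2 "ball z2 \<rho>2" "ball z1 \<rho>1 \<inter> ball z2 \<rho>2" f1])
       (use continue that in auto)
  thus ?case using continue by blast
qed

lemma hyp2F1_near_ode:
  assumes "hyp2F1_near a b 1 z0 F"
  obtains Z where "open Z" "z0 \<in> Z" "F holomorphic_on Z" "\<And>z. z \<in> Z \<Longrightarrow> hypergeo_ode a b F z = 0"
proof (cases "z0 \<in> hyp2F1_cut")
  case True
  then obtain \<rho> where "\<rho> > 0" "hyp2F1_element a b 1 z0 \<rho> F"
    using assms by (auto simp: hyp2F1_near_def)
  thus ?thesis using hyp2F1_element_ode[of a b z0 \<rho> F] that[of "ball z0 \<rho>"] by auto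
next
  case False
  hence F: "F = hyp2F1 a b 1" using assms by (simp add: hyp2F1_near_def)
  have "hypergeo_ode a b F z = 0" if "z \<in> - hyp2F1_cut" for z
    unfolding F
    by (rule hypergeo_ode_continuation[OF hyp2F1_principal_branch(1) open_slit_plane
          connected_slit_plane open_ball _ ball_subset_slit_plane hyp2F1_principal_branch(2)
          gauss_series_ode(2) that]) auto
  thus ?thesis
    using False hyp2F1_principal_branch(1) open_slit_plane by (intro that[of "- hyp2F1_cut"]) (auto simp: F)
qed

section \<open>Analytic branches of the power\<close>

text \<open>
  For a branch \<open>exp (\<alpha> L)\<close>, differentiating \<open>exp (L w) = w\<close> gives \<open>L' = 1 / w\<close>. The differential
  equation \<open>p' = \<alpha> p / w\<close> is a formulation common to all branches, the principal one
  included.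
\<close>

lemma power_near_derivative:
  assumes p: "power_near \<alpha> w0 p" and "w0 \<noteq> 0"
  obtains W where "open W" "w0 \<in> W" "0 \<notin> W"
    "\<And>w. w \<in> W \<Longrightarrow> (p has_field_derivative \<alpha> * p w / w) (at w)"
proof (cases "w0 \<in> \<real>\<^sub>\<le>\<^sub>0")
  case True
  then obtain \<rho> L where \<rho>: "\<rho> > 0" and L: "L holomorphic_on ball w0 \<rho>"
    "\<And>w. w \<in> ball w0 \<rho> \<Longrightarrow> exp (L w) = w" "\<And>w. w \<in> ball w0 \<rho> \<Longrightarrow> p w = exp (\<alpha> * L w)"
    using p by (auto simp: power_near_def)
  have "(p has_field_derivative \<alpha> * p w / w) (at w)" if w: "w \<in> ball w0 \<rho>" for w
  proof -
    have L': "(L has_field_derivative deriv L w) (at w)"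
      by (rule holomorphic_derivI[OF L(1) open_ball w])
    hence "((\<lambda>w. exp (L w)) has_field_derivative exp (L w) * deriv L w) (at w)"
      by (auto intro!: derivative_eq_intros)
    hence "((\<lambda>w. w) has_field_derivative exp (L w) * deriv L w) (at w)"
      by (rule has_field_derivative_transform_within_open[OF _ open_ball w]) (rule L(2))
    hence "exp (L w) * deriv L w = 1" using DERIV_unique DERIV_ident by blast
    hence L'': "deriv L w = 1 / w" using L(2)[OF w] by (metis exp_not_eq_zero nonzero_eq_divide_eq mult.commute)
    have "((\<lambda>w. exp (\<alpha> * L w)) has_field_derivative \<alpha> * p w / w) (at w)"
      using L(3)[OF w] by (auto intro!: derivative_eq_intros L' simp: L'')
    thus ?thesis
      by (rule has_field_derivative_transform_within_open[OF _ open_ball w]) (simp add: L(3))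
  qed
  moreover have "0 \<notin> ball w0 \<rho>" using L(2) exp_not_eq_zero by blast
  ultimately show ?thesis using \<rho> by (intro that[of "ball w0 \<rho>"]) auto
next
  case False
  hence p: "p = (\<lambda>w. w powr \<alpha>)" using p by (simp add: power_near_def)
  have "(p has_field_derivative \<alpha> * p w / w) (at w)" if "w \<notin> \<real>\<^sub>\<le>\<^sub>0" for w
  proof -
    have "w \<noteq> 0" using that by auto
    thus ?thesis unfolding p
      using has_field_derivative_powr[OF that, of \<alpha>] by (simp add: powr_diff powr_def[of w 1])
  qed
  thus ?thesis using False by (intro that[of "- \<real>\<^sub>\<le>\<^sub>0"]) auto
qed

section \<open>Second derivatives of the kernel\<close>

text \<open>
  Both \<open>t\<close> and \<open>r\<close> may be taken complex, since the kernel is holomorphic in each of them near the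
  point considered; the real derivatives are then restrictions of complex ones.
\<close>

lemma has_second_derivative_of_complex:
  fixes g g1 :: "complex \<Rightarrow> complex"
  assumes N: "open N" "complex_of_real x \<in> N"
    and g: "\<And>w. w \<in> N \<Longrightarrow> (g has_field_derivative g1 w) (at w)"
    and g1: "(g1 has_field_derivative d2) (at (complex_of_real x))"
  shows "has_second_derivative (\<lambda>s. g (complex_of_real s)) d2 x"
  unfolding has_second_derivative_def
proof (intro exI conjI)
  have "open (complex_of_real -` N)" by (intro open_vimage N continuous_intros)
  hence "eventually (\<lambda>s. s \<in> complex_of_real -` N) (nhds x)"
    using N by (intro eventually_nhds_in_open) auto
  thus "eventually (\<lambda>s. ((\<lambda>s. g (complex_of_real s)) has_vector_derivative g1 (of_real s)) (at s)) (nhds x)"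
    by eventually_elim (auto intro: has_vector_derivative_real_field g)
  show "((\<lambda>s. g1 (complex_of_real s)) has_vector_derivative d2) (at x)"
    by (rule has_vector_derivative_real_field[OF g1])
qed

text \<open>
  One formula serves both variables. The inner functions \<open>A\<close> and \<open>z\<close> are treated as independent,
  with derivatives \<open>a1, a2\<close> and \<open>b1, b2\<close> at the point.
\<close>

lemma power_times_hypergeo_second_derivative:
  fixes A A1 z z1 :: "complex \<Rightarrow> complex"
  assumes I: "open I" "of_real \<tau> \<in> I"
    and A: "\<And>s. s \<in> I \<Longrightarrow> (A has_field_derivative A1 s) (at s)"
           "(A1 has_field_derivative a2) (at (of_real \<tau>))"
    and z: "\<And>s. s \<in> I \<Longrightarrow> (z has_field_derivative z1 s) (at s)"
           "(z1 has_field_derivative b2) (at (of_real \<tau>))"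
    and vals: "A (of_real \<tau>) = a0" "A1 (of_real \<tau>) = a1" "z (of_real \<tau>) = b0" "z1 (of_real \<tau>) = b1"
    and W: "open W" "a0 \<in> W" "0 \<notin> W"
           "\<And>w. w \<in> W \<Longrightarrow> (P has_field_derivative \<alpha> * P w / w) (at w)"
    and Z: "open Z" "b0 \<in> Z" "F holomorphic_on Z"
  shows "has_second_derivative (\<lambda>s. c * P (A (of_real s)) * F (z (of_real s)))
     (c * P a0 *
       ((\<alpha> * (\<alpha> - 1) * a1\<^sup>2 / a0\<^sup>2 + \<alpha> * a2 / a0) * F b0
        + (b2 + 2 * \<alpha> * a1 * b1 / a0) * deriv F b0 + b1\<^sup>2 * deriv (deriv F) b0)) \<tau>"
proof -
  define N where "N = I \<inter> A -` W \<inter> (I \<inter> z -` Z)"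
  have "continuous_on I A" "continuous_on I z"
    using A(1) z(1) I by (auto intro!: DERIV_continuous_on intro: has_field_derivative_at_within)
  hence N_open: "open N" unfolding N_def
    using I W Z by (intro open_Int continuous_open_preimage) auto
  have N_mem: "of_real \<tau> \<in> N" using I W Z vals by (simp add: N_def)
  let ?g1 = "\<lambda>s. c * P (A s) * (\<alpha> * A1 s / A s * F (z s) + z1 s * deriv F (z s))"
  have F: "(F has_field_derivative deriv F w) (at w)"
          "(deriv F has_field_derivative deriv (deriv F) w) (at w)" if "w \<in> Z" for w
    using Z that by (auto intro: holomorphic_derivI holomorphic_deriv)
  have PA: "((\<lambda>s. P (A s)) has_field_derivative \<alpha> * P (A s) / A s * A1 s) (at s)"
    and Fz: "((\<lambda>s. F (z s)) has_field_derivative deriv F (z s) * z1 s) (at s)"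
    and dFz: "((\<lambda>s. deriv F (z s)) has_field_derivative deriv (deriv F) (z s) * z1 s) (at s)"
    and A': "(A has_field_derivative A1 s) (at s)" and nz: "A s \<noteq> 0"
    if "s \<in> N" for s
  proof -
    have s: "s \<in> I" "A s \<in> W" "z s \<in> Z" using that by (auto simp: N_def)
    show "((\<lambda>s. P (A s)) has_field_derivative \<alpha> * P (A s) / A s * A1 s) (at s)"
      by (rule DERIV_chain2[OF W(4)[OF s(2)] A(1)[OF s(1)]])
    show "((\<lambda>s. F (z s)) has_field_derivative deriv F (z s) * z1 s) (at s)"
      "((\<lambda>s. deriv F (z s)) has_field_derivative deriv (deriv F) (z s) * z1 s) (at s)"
      by (rule DERIV_chain2[OF F(1)[OF s(3)] z(1)[OF s(1)]], rule DERIV_chain2[OF F(2)[OF s(3)] z(1)[OF s(1)]])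
    show "(A has_field_derivative A1 s) (at s)" by (rule A(1)[OF s(1)])
    show "A s \<noteq> 0" using s W(3) by auto
  qed
  show ?thesis
  proof (rule has_second_derivative_of_complex[OF N_open N_mem, of _ ?g1], goal_cases)
    case (1 s)
    show ?case
      by (rule derivative_eq_intros PA[OF 1] Fz[OF 1] refl)+ (use nz[OF 1] in \<open>simp add: field_simps\<close>)
  next
    case 2
    show ?case
      unfolding vals[symmetric]
      by (rule derivative_eq_intros PA[OF N_mem] Fz[OF N_mem] dFz[OF N_mem] A'[OF N_mem] A(2) z(2)
          nz[OF N_mem] refl)+ (use nz[OF N_mem] in \<open>simp add: field_simps power2_eq_square\<close>)
  qed
qed

text \<open>
  \<open>\<phi>\<close> with a complex argument, for use with complex differentiation.
\<close>

definition phi_ext :: "complex \<Rightarrow> complex \<Rightarrow> complex" where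
  "phi_ext l w = 2 / (l + 2) * w powr ((l + 2) / 2)"

lemma phi_ext_derivative:
  assumes "l \<noteq> -2" "w \<notin> \<real>\<^sub>\<le>\<^sub>0"
  shows "(phi_ext l has_field_derivative w powr (l / 2)) (at w)"
    and "((\<lambda>w. w powr (l / 2)) has_field_derivative l / 2 * w powr (l / 2 - 1)) (at w)"
proof -
  have "l + 2 \<noteq> 0" using assms(1) by (metis add_eq_0_iff2)
  moreover have exponent: "(l + 2) / 2 - 1 = l / 2" by (simp add: add_divide_distrib)
  ultimately have "2 / (l + 2) * ((l + 2) / 2 * w powr ((l + 2) / 2 - 1)) = w powr (l / 2)"
    unfolding exponent by simp
  thus "(phi_ext l has_field_derivative w powr (l / 2)) (at w)"
    using DERIV_cmult[OF has_field_derivative_powr[OF assms(2), of "(l + 2) / 2"], of "2 / (l + 2)"]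
    by (simp only: phi_ext_def[abs_def])
  show "((\<lambda>w. w powr (l / 2)) has_field_derivative l / 2 * w powr (l / 2 - 1)) (at w)"
    by (rule has_field_derivative_powr[OF assms(2)])
qed

text \<open>
  This is \<open>\<phi> \<phi>'' = 2 \<gamma> (\<phi>')\<^sup>2\<close>, the relation that links the exponent \<open>\<gamma>\<close> to \<open>\<phi>\<close>.
\<close>

lemma phi_ext_second_order:
  "phi_ext l w * (l / 2 * w powr (l / 2 - 1)) = 2 * gam l * (w powr (l / 2))\<^sup>2"
proof -
  have powers: "w powr ((l + 2) / 2) * w powr (l / 2 - 1) = (w powr (l / 2))\<^sup>2"
    by (simp add: power2_eq_square add_divide_distrib flip: powr_add)
  have half: "2 * (l / (2 * k)) = l / k" for k :: complex by simp
  have regroup: "2 / k * u * (l / 2 * v) = l / k * (u * v)" for k u v :: complex by simp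
  have "phi_ext l w * (l / 2 * w powr (l / 2 - 1))
      = l / (l + 2) * (w powr ((l + 2) / 2) * w powr (l / 2 - 1))"
    unfolding phi_ext_def by (rule regroup)
  also have "\<dots> = 2 * gam l * (w powr (l / 2))\<^sup>2"
    unfolding powers gam_def by (simp only: half)
  finally show ?thesis .
qed

section \<open>The wave equation\<close>

text \<open>
  The chain-rule expressions for \<open>E\<^sub>t\<^sub>t\<close> and \<open>(\<phi>')\<^sup>2 E\<^sub>r\<^sub>r\<close>, divided by the common factor. Here
  \<open>z\<^sub>x = 4yD / A\<^sup>2\<close> and \<open>z\<^sub>r = -8xyr / A\<^sup>2\<close>. Comparing the coefficients of \<open>f2\<close>, \<open>f1\<close>, \<open>f0\<close>,
  the difference of the two sides is the left-hand side of Gauss's equation times \<open>\<kappa>\<close>. For \<open>f0\<close>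
  and \<open>f2\<close> this rests on \<open>A\<^sub>x\<^sup>2 - A\<^sub>r\<^sup>2 = 4A\<close> and
  \<open>D\<^sup>2 - 4x\<^sup>2r\<^sup>2 = ((x + y)\<^sup>2 - r\<^sup>2) ((x - y)\<^sup>2 - r\<^sup>2)\<close>.
\<close>

lemma wave_operator_identity:
  fixes x y r \<phi>1 \<phi>2 \<gamma> A D z f0 f1 f2 :: complex
  assumes x: "x \<noteq> 0" and A: "A \<noteq> 0" "A = (x + y)\<^sup>2 - r\<^sup>2"
    and D: "D = x\<^sup>2 - y\<^sup>2 + r\<^sup>2"
    and z: "z = ((x - y)\<^sup>2 - r\<^sup>2) / A"
    and phi: "x * \<phi>2 = 2 * \<gamma> * \<phi>1\<^sup>2"
    and ode: "z * (1 - z) * f2 + (1 - (\<gamma> + \<gamma> + 1) * z) * f1 - \<gamma> * \<gamma> * f0 = 0"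
  shows "((- \<gamma>) * (- \<gamma> - 1) * (2 * (x + y) * \<phi>1)\<^sup>2 / A\<^sup>2
            + (- \<gamma>) * (2 * \<phi>1\<^sup>2 + 2 * (x + y) * \<phi>2) / A) * f0
         + (4 * y * (2 * x * \<phi>1\<^sup>2 / A\<^sup>2 + D * \<phi>2 / A\<^sup>2 - 4 * D * (x + y) * \<phi>1\<^sup>2 / A ^ 3)
            + 2 * (- \<gamma>) * (2 * (x + y) * \<phi>1) * (4 * y * D * \<phi>1 / A\<^sup>2) / A) * f1
         + (4 * y * D * \<phi>1 / A\<^sup>2)\<^sup>2 * f2
       = \<phi>1\<^sup>2 * (((- \<gamma>) * (- \<gamma> - 1) * (- 2 * r)\<^sup>2 / A\<^sup>2 + (- \<gamma>) * (- 2) / A) * f0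
         + (- 8 * x * y * (1 / A\<^sup>2 + 4 * r\<^sup>2 / A ^ 3)
            + 2 * (- \<gamma>) * (- 2 * r) * (- 8 * x * y * r / A\<^sup>2) / A) * f1
         + (- 8 * x * y * r / A\<^sup>2)\<^sup>2 * f2)" (is "?L = ?R")
proof -
  have phi2: "\<phi>2 = 2 * \<gamma> * \<phi>1\<^sup>2 / x" using phi x by (simp add: field_simps)
  define \<kappa> where "\<kappa> = \<phi>1\<^sup>2 * 4 * y / (x * A)"
  have c0: "((- \<gamma>) * (- \<gamma> - 1) * (2 * (x + y) * \<phi>1)\<^sup>2 / A\<^sup>2
            + (- \<gamma>) * (2 * \<phi>1\<^sup>2 + 2 * (x + y) * \<phi>2) / A)
          - \<phi>1\<^sup>2 * ((- \<gamma>) * (- \<gamma> - 1) * (- 2 * r)\<^sup>2 / A\<^sup>2 + (- \<gamma>) * (- 2) / A)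
        = \<kappa> * (- (\<gamma> * \<gamma>))"
    unfolding phi2 \<kappa>_def using x A(1) by (simp add: divide_simps) (use A(2) in algebra)
  have c1: "(4 * y * (2 * x * \<phi>1\<^sup>2 / A\<^sup>2 + D * \<phi>2 / A\<^sup>2 - 4 * D * (x + y) * \<phi>1\<^sup>2 / A ^ 3)
            + 2 * (- \<gamma>) * (2 * (x + y) * \<phi>1) * (4 * y * D * \<phi>1 / A\<^sup>2) / A)
          - \<phi>1\<^sup>2 * (- 8 * x * y * (1 / A\<^sup>2 + 4 * r\<^sup>2 / A ^ 3)
            + 2 * (- \<gamma>) * (- 2 * r) * (- 8 * x * y * r / A\<^sup>2) / A)
        = \<kappa> * (1 - (\<gamma> + \<gamma> + 1) * z)"
    unfolding phi2 \<kappa>_def z D using x A(1) by (simp add: divide_simps) (use A(2) in algebra)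
  have c2: "(4 * y * D * \<phi>1 / A\<^sup>2)\<^sup>2 - \<phi>1\<^sup>2 * (- 8 * x * y * r / A\<^sup>2)\<^sup>2 = \<kappa> * (z * (1 - z))"
    unfolding \<kappa>_def z D using x A(1) by (simp add: divide_simps) (use A(2) in algebra)
  have lin: "(a0 * f0 + a1 * f1 + a2 * f2) - m * (b0 * f0 + b1 * f1 + b2 * f2)
      = (a0 - m * b0) * f0 + (a1 - m * b1) * f1 + (a2 - m * b2) * f2" for a0 a1 a2 b0 b1 b2 m
    by (simp add: algebra_simps)
  have "?L - ?R = \<kappa> * (z * (1 - z) * f2 + (1 - (\<gamma> + \<gamma> + 1) * z) * f1 - \<gamma> * \<gamma> * f0)"
    unfolding lin c0 c1 c2 by (simp add: algebra_simps)
  thus ?thesis unfolding ode by simp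
qed

theorem theorem2p1:
  fixes l :: complex and r t b :: real and P F :: "complex \<Rightarrow> complex"
  assumes "l \<noteq> -2"
    and "0 < b" and "b < t" and "0 < r"
    and "(complex_of_real r)\<^sup>2 \<noteq> (phi l t + phi l b)\<^sup>2"
    and "power_near (- gam l) (base_plus l r t b) P"
    and "hyp2F1_near (gam l) (gam l) 1 (base_minus l r t b / base_plus l r t b) F"
  shows "\<exists>Ett Err.
           has_second_derivative (\<lambda>s. kernel_E l P F r s b) Ett t \<and>
           has_second_derivative (\<lambda>\<rho>. kernel_E l P F \<rho> t b) Err r \<and>
           Ett - (vector_derivative (phi l) (at t))\<^sup>2 * Err = 0"
proof -
  let ?\<gamma> = "gam l" and ?t = "complex_of_real t" and ?r = "complex_of_real r"
  let ?\<phi>' = "\<lambda>w. w powr (l / 2)" and ?\<phi>'' = "\<lambda>w. l / 2 * w powr (l / 2 - 1)"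
  define x where "x = phi l t"
  define y where "y = phi l b"
  have phi_eq: "phi l s = phi_ext l (of_real s)" for s by (simp add: phi_def phi_ext_def)
  have t_slit: "?t \<notin> \<real>\<^sub>\<le>\<^sub>0" using assms(2,3) by (simp add: complex_nonpos_Reals_iff)
  have "l + 2 \<noteq> 0" using assms(1) by (metis add_eq_0_iff2)
  hence x_nz: "x \<noteq> 0" using assms(2,3) by (simp add: x_def phi_def)
  have A_nz: "(x + y)\<^sup>2 - ?r\<^sup>2 \<noteq> 0" using assms(5) by (auto simp: x_def y_def)
  have bp: "base_plus l \<rho> s b = (phi_ext l (of_real s) + y)\<^sup>2 - (of_real \<rho>)\<^sup>2"
    and bm: "base_minus l \<rho> s b = (phi_ext l (of_real s) - y)\<^sup>2 - (of_real \<rho>)\<^sup>2" for \<rho> s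
    by (simp_all add: base_plus_def base_minus_def phi_eq y_def)
  have x_ext: "phi_ext l ?t = x" by (simp add: x_def phi_eq)
  obtain W where W: "open W" "base_plus l r t b \<in> W" "0 \<notin> W"
    "\<And>w. w \<in> W \<Longrightarrow> (P has_field_derivative - ?\<gamma> * P w / w) (at w)"
    by (rule power_near_derivative[OF assms(6)]) (use A_nz in \<open>auto simp: bp x_ext\<close>)
  obtain Z where Z: "open Z" "base_minus l r t b / base_plus l r t b \<in> Z" "F holomorphic_on Z"
    "\<And>z. z \<in> Z \<Longrightarrow> hypergeo_ode ?\<gamma> ?\<gamma> F z = 0"
    by (rule hyp2F1_near_ode[OF assms(7)]) blast

  define A where "A = (x + y)\<^sup>2 - ?r\<^sup>2"
  define z where "z = ((x - y)\<^sup>2 - ?r\<^sup>2) / A"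
  define D where "D = x\<^sup>2 - y\<^sup>2 + ?r\<^sup>2"
  \<comment> \<open>the second derivative of the kernel in terms of the derivatives of \<open>A\<close> and \<open>z\<close>\<close>
  define E where "E a1 a2 z1 z2 = c_const l * P A *
     ((- ?\<gamma> * (- ?\<gamma> - 1) * a1\<^sup>2 / A\<^sup>2 + - ?\<gamma> * a2 / A) * F z
        + (z2 + 2 * - ?\<gamma> * a1 * z1 / A) * deriv F z + z1\<^sup>2 * deriv (deriv F) z)" for a1 a2 z1 z2
  define Ett where "Ett = E (2 * (x + y) * ?\<phi>' ?t) (2 * (?\<phi>' ?t)\<^sup>2 + 2 * (x + y) * ?\<phi>'' ?t)
     (4 * y * D * ?\<phi>' ?t / A\<^sup>2)
     (4 * y * (2 * x * (?\<phi>' ?t)\<^sup>2 / A\<^sup>2 + D * ?\<phi>'' ?t / A\<^sup>2 - 4 * D * (x + y) * (?\<phi>' ?t)\<^sup>2 / A ^ 3))"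
  define Err where "Err = E (- 2 * ?r) (- 2) (- 8 * x * y * ?r / A\<^sup>2)
     (- 8 * x * y * (1 / A\<^sup>2 + 4 * ?r\<^sup>2 / A ^ 3))"
  have A0: "A \<noteq> 0" using A_nz by (simp add: A_def)

  have "has_second_derivative (\<lambda>s. kernel_E l P F r s b) Ett t"
  proof -
    let ?A = "\<lambda>w. (phi_ext l w + y)\<^sup>2 - ?r\<^sup>2"
    define I where "I = {w. w \<notin> \<real>\<^sub>\<le>\<^sub>0 \<and> ?A w \<noteq> 0}"
    have phi': "(phi_ext l has_field_derivative ?\<phi>' w) (at w)"
      and phi'': "(?\<phi>' has_field_derivative ?\<phi>'' w) (at w)" if "w \<notin> \<real>\<^sub>\<le>\<^sub>0" for w
      using phi_ext_derivative[OF assms(1) that] by auto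
    have I: "open I" "?t \<in> I"
    proof -
      have "continuous_on (- \<real>\<^sub>\<le>\<^sub>0) (phi_ext l)"
        using phi' by (auto intro!: DERIV_continuous_on intro: has_field_derivative_at_within)
      hence "open (- \<real>\<^sub>\<le>\<^sub>0 \<inter> ?A -` (- {0}))"
        by (intro continuous_open_preimage continuous_intros) auto
      also have "- \<real>\<^sub>\<le>\<^sub>0 \<inter> ?A -` (- {0}) = I" by (auto simp: I_def)
      finally show "open I" .
      show "?t \<in> I" using t_slit A_nz unfolding I_def mem_Collect_eq x_ext by blast
    qed
    have "has_second_derivative (\<lambda>s. c_const l * P (?A (of_real s))
        * F (((phi_ext l (of_real s) - y)\<^sup>2 - ?r\<^sup>2) / ?A (of_real s))) Ett t"
      unfolding Ett_def E_def
    proof (rule power_times_hypergeo_second_derivative[OF I, where A = ?A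
          and z = "\<lambda>w. ((phi_ext l w - y)\<^sup>2 - ?r\<^sup>2) / ?A w"
          and ?A1.0 = "\<lambda>w. 2 * (phi_ext l w + y) * ?\<phi>' w"
          and ?z1.0 = "\<lambda>w. 4 * y * ((phi_ext l w)\<^sup>2 - y\<^sup>2 + ?r\<^sup>2) * ?\<phi>' w / (?A w)\<^sup>2"
          and W = W and Z = Z])
      fix w assume w: "w \<in> I"
      hence nz: "?A w \<noteq> 0" and slit: "w \<notin> \<real>\<^sub>\<le>\<^sub>0" by (auto simp: I_def)
      show "(?A has_field_derivative 2 * (phi_ext l w + y) * ?\<phi>' w) (at w)"
        by (rule phi'[OF slit] derivative_eq_intros refl)+ (simp add: algebra_simps)
      show "((\<lambda>w. ((phi_ext l w - y)\<^sup>2 - ?r\<^sup>2) / ?A w) has_field_derivative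
          4 * y * ((phi_ext l w)\<^sup>2 - y\<^sup>2 + ?r\<^sup>2) * ?\<phi>' w / (?A w)\<^sup>2) (at w)"
        by (rule phi'[OF slit] derivative_eq_intros nz refl)+
           (use nz in \<open>simp add: divide_simps\<close>, algebra)
    next
      note phi_t = phi'[OF t_slit] phi''[OF t_slit]
      show "((\<lambda>w. 2 * (phi_ext l w + y) * ?\<phi>' w) has_field_derivative
          2 * (?\<phi>' ?t)\<^sup>2 + 2 * (x + y) * ?\<phi>'' ?t) (at ?t)"
        by (rule phi_t derivative_eq_intros refl)+ (simp add: x_ext algebra_simps power2_eq_square)
      show "((\<lambda>w. 4 * y * ((phi_ext l w)\<^sup>2 - y\<^sup>2 + ?r\<^sup>2) * ?\<phi>' w / (?A w)\<^sup>2) has_field_derivative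
          4 * y * (2 * x * (?\<phi>' ?t)\<^sup>2 / A\<^sup>2 + D * ?\<phi>'' ?t / A\<^sup>2
            - 4 * D * (x + y) * (?\<phi>' ?t)\<^sup>2 / A ^ 3)) (at ?t)"
        apply (rule phi_t derivative_eq_intros refl)+
        subgoal using A_nz by (simp add: x_ext)
        subgoal unfolding x_ext A_def[symmetric] D_def[symmetric] using A0
          by (simp add: field_simps eval_nat_numeral)
        done
    qed (use W Z in \<open>auto simp: bp bm x_ext A_def z_def D_def\<close>)
    thus ?thesis by (simp only: kernel_E_def bp bm)
  qed
  moreover have "has_second_derivative (\<lambda>\<rho>. kernel_E l P F \<rho> t b) Err r"
  proof -
    let ?A = "\<lambda>w. (x + y)\<^sup>2 - w\<^sup>2"
    define I where "I = {w. ?A w \<noteq> 0}"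
    have I: "open I" "?r \<in> I"
      unfolding I_def using A_nz by (auto intro!: open_Collect_neq continuous_intros)
    have "has_second_derivative (\<lambda>\<rho>. c_const l * P (?A (of_real \<rho>))
        * F (((x - y)\<^sup>2 - (of_real \<rho>)\<^sup>2) / ?A (of_real \<rho>))) Err r"
      unfolding Err_def E_def
    proof (rule power_times_hypergeo_second_derivative[OF I, where A = ?A
          and z = "\<lambda>w. ((x - y)\<^sup>2 - w\<^sup>2) / ?A w"
          and ?A1.0 = "\<lambda>w. - 2 * w"
          and ?z1.0 = "\<lambda>w. - 8 * x * y * w / (?A w)\<^sup>2"
          and W = W and Z = Z])
      fix w assume w: "w \<in> I"
      hence nz: "?A w \<noteq> 0" by (auto simp: I_def)
      show "(?A has_field_derivative - 2 * w) (at w)"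
        by (rule derivative_eq_intros refl)+ simp
      show "((\<lambda>w. ((x - y)\<^sup>2 - w\<^sup>2) / ?A w) has_field_derivative - 8 * x * y * w / (?A w)\<^sup>2) (at w)"
        by (rule derivative_eq_intros nz refl)+
           (use nz in \<open>simp add: divide_simps\<close>, algebra)
    next
      show "((\<lambda>w. - 2 * w) has_field_derivative - 2) (at ?r)"
        by (rule derivative_eq_intros refl)+ simp
      show "((\<lambda>w. - 8 * x * y * w / (?A w)\<^sup>2) has_field_derivative
          - 8 * x * y * (1 / A\<^sup>2 + 4 * ?r\<^sup>2 / A ^ 3)) (at ?r)"
        apply (rule derivative_eq_intros refl)+
        subgoal using A_nz by simp
        subgoal unfolding A_def[symmetric] using A0
          by (simp add: field_simps eval_nat_numeral)
        done
    qed (use W Z in \<open>auto simp: bp bm x_ext A_def z_def\<close>)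
    thus ?thesis by (simp only: kernel_E_def bp bm x_ext)
  qed
  moreover have "Ett = (?\<phi>' ?t)\<^sup>2 * Err"
  proof -
    have "hypergeo_ode ?\<gamma> ?\<gamma> F z = 0"
      using Z(2,4) by (simp add: bp bm x_ext A_def z_def)
    from wave_operator_identity[OF x_nz A0 A_def D_def z_def
        phi_ext_second_order[of l ?t, unfolded x_ext] this[unfolded hypergeo_ode_def]]
    show ?thesis unfolding Ett_def Err_def E_def by (simp only: mult.left_commute[of "(?\<phi>' ?t)\<^sup>2"])
  qed
  moreover have "vector_derivative (phi l) (at t) = ?\<phi>' ?t"
    unfolding phi_eq[abs_def]
    by (intro vector_derivative_at has_vector_derivative_real_field phi_ext_derivative assms(1) t_slit)
  ultimately show ?thesis by auto
qed

end
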